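(* The exponential B-spline collocation scheme described in the context is unconditionally stable (in the von Neumann sense specified there). That is: let $0<\alpha<1$, $\kappa>0$, $p>0$, $a<b$, $T>0$, $M,N\in\mathbb{N}^+$ be arbitrary, $h=(b-a)/M$, $\tau=T/N$, with no relation assumed between $\tau$ and $h$. Let $\upsilon\in\mathbb{R}$ be any wave number and let $\zeta_\upsilon^0,\zeta_\upsilon^1,\dots,\zeta_\upsilon^N\in\mathbb{C}$ be such that the mode $\rho^n_j=\zeta^n_\upsilon\exp(\mathrm{i}\upsilon jh)$ satisfies, for all $n=1,\dots,N$ and $j=0,1,\dots,M$, the perturbation equation $$A\rho^n_{j-1}+A'\rho^n_j+A\rho^n_{j+1}=-\sum_{k=1}^{n-1}\omega^\alpha_kZ^{n-k}_j+\sum_{k=0}^{n-1}\omega^\alpha_kZ_j^0,$$ where $Z^m_j=(s-ph)\rho^m_{j-1}+2(phc-s)\rho^m_j+(s-ph)\rho^m_{j+1}$. Then $$|\zeta^n_\upsilon|\le|\zeta^0_\upsilon|\qquad\text{for all } n=1,\dots,N .$$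
   Context: The scheme discretizes the fractional sub-diffusion problem $\partial_t^\alpha u-\kappa\,\partial_x^2u=f(x,t)$ on $a<x<b$, $0<t\le T$ (Caputo derivative in time, $0<\alpha<1$) with prescribed initial data and Dirichlet boundary data. The approximate solution is $u_N(x,t_n)=\sum_{j=-1}^{M+1}\alpha_j^nB_j(x)$, where the $B_j$ are exponential B-splines with tension parameter $p>0$ on the uniform mesh $x_j=a+jh$, and $t_n=n\tau$. With $s=\sinh(ph)$, $c=\cosh(ph)$, and $\omega^\alpha_k=(-1)^k\binom{\alpha}{k}$ for $k\ge0$ (so $\omega_0^\alpha=1$), collocation at the nodes $x_j$, $j=0,\dots,M$, gives $$A\alpha^n_{j-1}+A'\alpha^n_j+A\alpha^n_{j+1}=-\sum_{k=1}^{n-1}\omega^\alpha_kP^{n-k}_j+\sum_{k=0}^{n-1}\omega^\alpha_kP_j^0+2\tau^\alpha(phc-s)f(x_j,t_n),$$ where $$A=-\tau^\alpha\kappa p^2s+\omega^\alpha_0(s-ph),\qquad A'=2\tau^\alpha\kappa p^2s+2\omega^\alpha_0(phc-s),$$ $$P^m_j=(s-ph)\alpha^m_{j-1}+2(phc-s)\alpha^m_j+(s-ph)\alpha^m_{j+1}.$$ Empty sums are $0$. Meaning of stability: if $\tilde\alpha^n_j$ is a perturbed solution, the perturbation $\rho^n_j=\alpha^n_j-\tilde\alpha^n_j$ satisfies the homogeneous counterpart of this equation (the perturbation equation in the claim). Unconditional stability (fractional von Neumann approach) means that for every generic Fourier mode $\rho^n_j=\zeta^n_\upsilon\exp(\mathrm{i}\upsilon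 jh)$, $\mathrm{i}=\sqrt{-1}$, solving this homogeneous equation, the amplitude at any time level is bounded by the initial one, $|\zeta^n_\upsilon|\le|\zeta^0_\upsilon|$, with no restriction on $\tau$ and $h$. *)

theory Defs
  imports Complex_Main
begin

definition frac_weight :: "real \<Rightarrow> nat \<Rightarrow> real" where
  "frac_weight \<alpha> k = (-1) ^ k * (\<alpha> gchoose k)"

definition coeff_off :: "real \<Rightarrow> real \<Rightarrow> real \<Rightarrow> real \<Rightarrow> real \<Rightarrow> real" where
  "coeff_off \<alpha> \<kappa> p h \<tau> =
     - (\<tau> powr \<alpha>) * \<kappa> * p\<^sup>2 * sinh (p * h) + frac_weight \<alpha> 0 * (sinh (p * h) - p * h)"

definition coeff_diag :: "real \<Rightarrow> real \<Rightarrow> real \<Rightarrow> real \<Rightarrow> real \<Rightarrow> real" where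
  "coeff_diag \<alpha> \<kappa> p h \<tau> =
     2 * (\<tau> powr \<alpha>) * \<kappa> * p\<^sup>2 * sinh (p * h)
     + 2 * frac_weight \<alpha> 0 * (p * h * cosh (p * h) - sinh (p * h))"

text \<open>
  Grid functions take an integer space index, because the spline coefficients carry the
  indices \<open>-1, \<dots>, M + 1\<close>. The operator below maps the coefficients at one time level to
  the term written P (for the solution) or Z (for the perturbation) in the scheme.
\<close>

definition spline_stencil :: "real \<Rightarrow> real \<Rightarrow> (int \<Rightarrow> complex) \<Rightarrow> int \<Rightarrow> complex" where
  "spline_stencil p h r j =
     of_real (sinh (p * h) - p * h) * r (j - 1)
     + of_real (2 * (p * h * cosh (p * h) - sinh (p * h))) * r j
     + of_real (sinh (p * h) - p * h) * r (j + 1)"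

text \<open>
  The homogeneous counterpart of the collocation equation at time level \<open>n\<close> and node \<open>j\<close>,
  for a perturbation \<open>\<rho> n j\<close>. For \<open>n = 1\<close> the first sum is empty.
\<close>

definition perturbation_eq ::
  "real \<Rightarrow> real \<Rightarrow> real \<Rightarrow> real \<Rightarrow> real \<Rightarrow> (nat \<Rightarrow> int \<Rightarrow> complex) \<Rightarrow> nat \<Rightarrow> int \<Rightarrow> bool" where
  "perturbation_eq \<alpha> \<kappa> p h \<tau> \<rho> n j \<longleftrightarrow>
     of_real (coeff_off \<alpha> \<kappa> p h \<tau>) * \<rho> n (j - 1)
     + of_real (coeff_diag \<alpha> \<kappa> p h \<tau>) * \<rho> n j
     + of_real (coeff_off \<alpha> \<kappa> p h \<tau>) * \<rho> n (j + 1)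
     = - (\<Sum>k\<in>{1..<n}. of_real (frac_weight \<alpha> k) * spline_stencil p h (\<rho> (n - k)) j)
       + (\<Sum>k\<in>{0..<n}. of_real (frac_weight \<alpha> k) * spline_stencil p h (\<rho> 0) j)"

definition fourier_mode :: "(nat \<Rightarrow> complex) \<Rightarrow> real \<Rightarrow> real \<Rightarrow> nat \<Rightarrow> int \<Rightarrow> complex" where
  "fourier_mode \<zeta> \<upsilon> h n j = \<zeta> n * exp (\<i> * of_real (\<upsilon> * of_int j * h))"

end

theory Submission
  imports Defs
begin

text \<open>
  On a Fourier mode the stencil acts as multiplication by a real symbol \<open>S\<close>, and the
  left-hand side of the scheme as multiplication by \<open>S + D\<close>, where
  \<open>D = 2 \<tau>\<^sup>\<alpha> \<kappa> p\<^sup>2 s (1 - cos (\<upsilon> h)) \<ge> 0\<close> and \<open>S > 0\<close> because \<open>2 s < p h (c + 1)\<close>.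
  The weights of index \<open>k \<ge> 1\<close> are nonpositive and the partial sums of the weights are nonnegative,
  so by strong induction the right-hand side is at most
  \<open>S (- (\<omega>\<^sub>1 + \<dots> + \<omega>\<^sub>n\<^sub>-\<^sub>1) + (\<omega>\<^sub>0 + \<dots> + \<omega>\<^sub>n\<^sub>-\<^sub>1)) |\<zeta>\<^sup>0| = S |\<zeta>\<^sup>0|\<close> in modulus.
\<close>

lemma frac_weight_0 [simp]: "frac_weight \<alpha> 0 = 1"
  by (simp add: frac_weight_def)

text \<open>The factor makes signs readable: it is nonnegative for every \<open>k\<close> when
  \<open>\<alpha> \<le> 0\<close>, and for \<open>k \<ge> 1\<close> when
  \<open>\<alpha> \<le> 1\<close>.\<close>

lemma frac_weight_Suc:
  "frac_weight \<alpha> (Suc k) = frac_weight \<alpha> k * ((real k - \<alpha>) / real (Suc k))"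
proof -
  have "\<alpha> * (\<alpha> gchoose k) = real k * (\<alpha> gchoose k) + real (Suc k) * (\<alpha> gchoose Suc k)"
    by (rule gbinomial_mult_1)
  then have "\<alpha> gchoose Suc k = - ((\<alpha> gchoose k) * ((real k - \<alpha>) / real (Suc k)))"
    by (simp add: field_simps)
  then show ?thesis
    by (simp add: frac_weight_def)
qed

lemma frac_weight_nonneg:
  assumes "\<alpha> \<le> 0"
  shows "0 \<le> frac_weight \<alpha> k"
proof (induction k)
  case (Suc k)
  then show ?case
    using assms by (simp add: frac_weight_Suc)
qed simp

lemma frac_weight_nonpos:
  assumes "0 \<le> \<alpha>" "\<alpha> \<le> 1" "k > 0"
  shows "frac_weight \<alpha> k \<le> 0"
  using \<open>k > 0\<close>
proof (induction k rule: nat_induct_non_zero)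
  case 1
  then show ?case
    using assms by (simp add: frac_weight_def)
next
  case (Suc k)
  then show ?case
    using assms unfolding frac_weight_Suc by (intro mult_nonpos_nonneg) auto
qed

text \<open>Summation divides the generating function \<open>(1 - z) powr \<alpha>\<close> by
  \<open>1 - z\<close>, which lowers the exponent by one. For \<open>\<alpha> \<le> 1\<close> the
  new exponent is at most 0, so \<open>frac_weight_nonneg\<close> gives the sign of the partial
  sums.\<close>

lemma sum_frac_weight:
  "(\<Sum>k\<le>n. frac_weight \<alpha> k) = frac_weight (\<alpha> - 1) n"
  using gbinomial_sum_lower_neg[of \<alpha> n] by (simp add: frac_weight_def mult.commute)

text \<open>Mean value theorem for \<open>sinh\<close> on \<open>[0, x]\<close>; comparing
  \<open>cosh z\<close> with \<open>cosh 0\<close> and \<open>cosh x\<close> gives the next two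
  bounds.\<close>

lemma sinh_eq_mult_cosh:
  fixes x :: real
  assumes "0 < x"
  obtains z where "0 < z" "z < x" "sinh x = x * cosh z"
proof -
  have "\<exists>z>0. z < x \<and> sinh x - sinh 0 = (x - 0) * cosh z"
    using assms by (intro MVT2) (auto intro!: derivative_eq_intros)
  then show thesis
    using that by auto
qed

lemma less_sinh:
  fixes x :: real
  assumes "0 < x"
  shows "x < sinh x"
proof -
  obtain z where "0 < z" "sinh x = x * cosh z"
    using assms by (rule sinh_eq_mult_cosh)
  moreover have "cosh 0 < cosh z"
    using \<open>0 < z\<close> by (intro cosh_real_strict_mono) auto
  ultimately show ?thesis
    using assms by simp
qed

lemma sinh_less_mult_cosh:
  fixes x :: real
  assumes "0 < x"
  shows "sinh x < x * cosh x"
proof -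
  obtain z where "0 < z" "z < x" "sinh x = x * cosh z"
    using assms by (rule sinh_eq_mult_cosh)
  moreover have "cosh z < cosh x"
    using \<open>0 < z\<close> \<open>z < x\<close> by (intro cosh_real_strict_mono) auto
  ultimately show ?thesis
    using assms by simp
qed

text \<open>Passing to the half argument \<open>y\<close> reduces this to
  \<open>sinh y < y * cosh y\<close>.\<close>

lemma two_sinh_less:
  fixes x :: real
  assumes "0 < x"
  shows "2 * sinh x < x * (cosh x + 1)"
proof -
  define y where "y = x / 2"
  have x: "x = 2 * y" and "0 < y"
    using assms by (auto simp: y_def)
  have "2 * sinh x = 4 * cosh y * sinh y"
    by (simp add: x sinh_double)
  also have "\<dots> < 4 * cosh y * (y * cosh y)"
    using sinh_less_mult_cosh[OF \<open>0 < y\<close>] by simp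
  also have "\<dots> = x * (2 * (cosh y)\<^sup>2)"
    by (simp add: x power2_eq_square)
  also have "2 * (cosh y)\<^sup>2 = cosh x + 1"
    by (simp add: x cosh_double sinh_square_eq)
  finally show ?thesis .
qed

definition stencil_symbol :: "real \<Rightarrow> real \<Rightarrow> real \<Rightarrow> real" where
  "stencil_symbol p h \<upsilon> =
     2 * (sinh (p * h) - p * h) * cos (\<upsilon> * h) + 2 * (p * h * cosh (p * h) - sinh (p * h))"

text \<open>With \<open>x = p * h\<close>, the symbol is
  \<open>2 * (sinh x - x) * (1 + cos (\<upsilon> * h))\<close> plus
  \<open>2 * (x * (cosh x + 1) - 2 * sinh x)\<close>: a nonnegative and a positive term.\<close>

lemma stencil_symbol_pos:
  assumes "0 < p" "0 < h"
  shows "0 < stencil_symbol p h \<upsilon>"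
proof -
  have ph: "0 < p * h"
    using assms by simp
  have "0 \<le> (sinh (p * h) - p * h) * (1 + cos (\<upsilon> * h))"
    using less_sinh[OF ph] cos_ge_minus_one[of "\<upsilon> * h"] by (intro mult_nonneg_nonneg) linarith+
  then show ?thesis
    using two_sinh_less[OF ph] by (simp add: stencil_symbol_def algebra_simps)
qed

lemma fourier_mode_0 [simp]: "fourier_mode \<zeta> \<upsilon> h n 0 = \<zeta> n"
  by (simp add: fourier_mode_def)

lemma fourier_mode_neighbours:
  "fourier_mode \<zeta> \<upsilon> h n (- 1) + fourier_mode \<zeta> \<upsilon> h n 1 = of_real (2 * cos (\<upsilon> * h)) * \<zeta> n"
proof -
  have "exp (\<i> * of_real (- (\<upsilon> * h))) + exp (\<i> * of_real (\<upsilon> * h)) = of_real (2 * cos (\<upsilon> * h))"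
    by (simp add: complex_eq_iff Re_exp Im_exp)
  then show ?thesis
    by (simp add: fourier_mode_def distrib_left[symmetric] mult.commute)
qed

text \<open>Kept generic in \<open>A\<close> and \<open>B\<close> to serve both the spline stencil
  and the left-hand side of the scheme.\<close>

lemma symmetric_stencil_fourier_mode:
  "of_real A * fourier_mode \<zeta> \<upsilon> h n (- 1) + of_real B * \<zeta> n + of_real A * fourier_mode \<zeta> \<upsilon> h n 1
     = of_real (2 * A * cos (\<upsilon> * h) + B) * \<zeta> n"
proof -
  have "of_real A * fourier_mode \<zeta> \<upsilon> h n (- 1) + of_real B * \<zeta> n + of_real A * fourier_mode \<zeta> \<upsilon> h n 1
      = of_real A * (fourier_mode \<zeta> \<upsilon> h n (- 1) + fourier_mode \<zeta> \<upsilon> h n 1) + of_real B * \<zeta> n"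
    by (simp add: algebra_simps)
  then show ?thesis
    unfolding fourier_mode_neighbours by (simp add: algebra_simps)
qed

lemma spline_stencil_fourier_mode:
  "spline_stencil p h (fourier_mode \<zeta> \<upsilon> h n) 0 = of_real (stencil_symbol p h \<upsilon>) * \<zeta> n"
proof -
  have "spline_stencil p h (fourier_mode \<zeta> \<upsilon> h n) 0 =
      of_real (sinh (p * h) - p * h) * fourier_mode \<zeta> \<upsilon> h n (- 1)
      + of_real (2 * (p * h * cosh (p * h) - sinh (p * h))) * \<zeta> n
      + of_real (sinh (p * h) - p * h) * fourier_mode \<zeta> \<upsilon> h n 1"
    by (simp add: spline_stencil_def)
  then show ?thesis
    unfolding symmetric_stencil_fourier_mode stencil_symbol_def .
qed

text \<open>At node 0 the exponential equals 1, so the scheme becomes a scalar recursion for the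
  amplitudes.\<close>

lemma perturbation_eq_fourier_mode:
  assumes "perturbation_eq \<alpha> \<kappa> p h \<tau> (fourier_mode \<zeta> \<upsilon> h) n 0"
  shows "of_real (stencil_symbol p h \<upsilon>
           + 2 * (\<tau> powr \<alpha>) * \<kappa> * p\<^sup>2 * sinh (p * h) * (1 - cos (\<upsilon> * h))) * \<zeta> n
         = of_real (stencil_symbol p h \<upsilon>)
           * (- (\<Sum>k\<in>{1..<n}. of_real (frac_weight \<alpha> k) * \<zeta> (n - k))
              + of_real (\<Sum>k\<in>{0..<n}. frac_weight \<alpha> k) * \<zeta> 0)"
    (is "of_real ?L * _ = of_real ?S * ?R")
proof -
  have "of_real (2 * coeff_off \<alpha> \<kappa> p h \<tau> * cos (\<upsilon> * h) + coeff_diag \<alpha> \<kappa> p h \<tau>) * \<zeta> n =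
      of_real (coeff_off \<alpha> \<kappa> p h \<tau>) * fourier_mode \<zeta> \<upsilon> h n (- 1)
      + of_real (coeff_diag \<alpha> \<kappa> p h \<tau>) * \<zeta> n
      + of_real (coeff_off \<alpha> \<kappa> p h \<tau>) * fourier_mode \<zeta> \<upsilon> h n 1"
    by (rule symmetric_stencil_fourier_mode[symmetric])
  also have "\<dots> = - (\<Sum>k\<in>{1..<n}. of_real (frac_weight \<alpha> k) * (of_real ?S * \<zeta> (n - k)))
       + (\<Sum>k\<in>{0..<n}. of_real (frac_weight \<alpha> k) * (of_real ?S * \<zeta> 0))"
    using assms unfolding perturbation_eq_def spline_stencil_fourier_mode by simp
  also have "\<dots> = of_real ?S * ?R"
    by (simp add: right_diff_distrib sum_distrib_left sum_distrib_right mult_ac)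
  \<comment> \<open>The \<open>frac_weight \<alpha> 0\<close> parts of the coefficients assemble
    into the symbol, the \<open>\<tau> powr \<alpha>\<close> parts into the damping term.\<close>
  also have "2 * coeff_off \<alpha> \<kappa> p h \<tau> * cos (\<upsilon> * h) + coeff_diag \<alpha> \<kappa> p h \<tau> = ?L"
    by (simp add: coeff_off_def coeff_diag_def stencil_symbol_def algebra_simps)
  finally show ?thesis .
qed

text \<open>The bracket is a convex combination of amplitudes: the coefficients
  \<open>- frac_weight \<alpha> k\<close> for \<open>1 \<le> k < n\<close> and the partial sum are
  nonnegative and add up to \<open>frac_weight \<alpha> 0 = 1\<close>.\<close>

lemma cmod_memory_sum_le:
  assumes "0 \<le> \<alpha>" "\<alpha> \<le> 1" "n > 0"
    and bound: "\<And>m. 0 < m \<Longrightarrow> m < n \<Longrightarrow> cmod (\<zeta> m) \<le> cmod (\<zeta> 0)"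
  shows "cmod (- (\<Sum>k\<in>{1..<n}. of_real (frac_weight \<alpha> k) * \<zeta> (n - k))
                + of_real (\<Sum>k\<in>{0..<n}. frac_weight \<alpha> k) * \<zeta> 0) \<le> cmod (\<zeta> 0)"
    (is "cmod (- ?U + of_real ?W * _) \<le> _")
proof -
  have "{0..<n} = {..n - 1}"
    using \<open>n > 0\<close> by auto
  then have W: "0 \<le> ?W"
    using assms by (simp add: sum_frac_weight frac_weight_nonneg)
  have "cmod ?U \<le> (\<Sum>k\<in>{1..<n}. - frac_weight \<alpha> k * cmod (\<zeta> 0))"
  proof (rule sum_norm_le)
    fix k assume k: "k \<in> {1..<n}"
    then have "frac_weight \<alpha> k \<le> 0"
      using assms by (intro frac_weight_nonpos) auto
    then have "cmod (of_real (frac_weight \<alpha> k) * \<zeta> (n - k)) = - frac_weight \<alpha> k * cmod (\<zeta> (n - k))"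
      by (simp add: norm_mult)
    also have "\<dots> \<le> - frac_weight \<alpha> k * cmod (\<zeta> 0)"
      using k \<open>frac_weight \<alpha> k \<le> 0\<close> by (intro mult_left_mono bound) auto
    finally show "cmod (of_real (frac_weight \<alpha> k) * \<zeta> (n - k)) \<le> - frac_weight \<alpha> k * cmod (\<zeta> 0)" .
  qed
  \<comment> \<open>Splitting the term \<open>k = 0\<close> off \<open>?W\<close> leaves the sum
    over \<open>{1..<n}\<close>.\<close>
  also have "\<dots> = (1 - ?W) * cmod (\<zeta> 0)"
    using \<open>n > 0\<close> by (simp add: sum.atLeast_Suc_lessThan sum_negf flip: sum_distrib_right)
  finally have "cmod ?U \<le> (1 - ?W) * cmod (\<zeta> 0)" .
  moreover have "cmod (- ?U + of_real ?W * \<zeta> 0) \<le> cmod ?U + ?W * cmod (\<zeta> 0)"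
    using norm_triangle_ineq[of "- ?U" "of_real ?W * \<zeta> 0"] W
    by (simp only: norm_minus_cancel norm_mult norm_of_real abs_of_nonneg)
  ultimately show ?thesis
    by (simp add: algebra_simps)
qed

theorem theorem5p1:
  fixes \<alpha> \<kappa> p a b T h \<tau> \<upsilon> :: real
    and M N :: nat
    and \<zeta> :: "nat \<Rightarrow> complex"
  assumes "0 < \<alpha>" and "\<alpha> < 1"
    and "\<kappa> > 0" and "p > 0"
    and "a < b" and "T > 0"
    and "M > 0" and "N > 0"
    and "h = (b - a) / real M"
    and "\<tau> = T / real N"
    and "\<And>n j. n \<in> {1..N} \<Longrightarrow> j \<in> {0..int M} \<Longrightarrow>
           perturbation_eq \<alpha> \<kappa> p h \<tau> (fourier_mode \<zeta> \<upsilon> h) n j"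
  shows "\<forall>n\<in>{1..N}. cmod (\<zeta> n) \<le> cmod (\<zeta> 0)"
proof -
  have h: "0 < h"
    using assms by simp
  define S where "S = stencil_symbol p h \<upsilon>"
  define D where "D = 2 * (\<tau> powr \<alpha>) * \<kappa> * p\<^sup>2 * sinh (p * h) * (1 - cos (\<upsilon> * h))"
  have S: "0 < S"
    unfolding S_def using \<open>p > 0\<close> h by (rule stencil_symbol_pos)
  have D: "0 \<le> D"
    unfolding D_def using \<open>p > 0\<close> \<open>\<kappa> > 0\<close> h by simp
  have "cmod (\<zeta> n) \<le> cmod (\<zeta> 0)" if "0 < n" "n \<le> N" for n
    using that
  proof (induction n rule: less_induct)
    case (less n)
    let ?R = "- (\<Sum>k\<in>{1..<n}. of_real (frac_weight \<alpha> k) * \<zeta> (n - k))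
              + of_real (\<Sum>k\<in>{0..<n}. frac_weight \<alpha> k) * \<zeta> 0"
    have "perturbation_eq \<alpha> \<kappa> p h \<tau> (fourier_mode \<zeta> \<upsilon> h) n 0"
      using less.prems by (intro assms) auto
    then have "of_real (S + D) * \<zeta> n = of_real S * ?R"
      unfolding S_def D_def by (rule perturbation_eq_fourier_mode)
    then have "cmod (of_real (S + D) * \<zeta> n) = cmod (of_real S * ?R)"
      by (rule arg_cong)
    then have eq: "(S + D) * cmod (\<zeta> n) = S * cmod ?R"
      using S D by (simp only: norm_mult norm_of_real abs_of_pos add_pos_nonneg)
    \<comment> \<open>Dropping \<open>D\<close> requires only its sign, so no relation between
      \<open>\<tau>\<close> and \<open>h\<close> enters.\<close>
    have "S * cmod (\<zeta> n) \<le> (S + D) * cmod (\<zeta> n)"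
      using D by (intro mult_right_mono) auto
    also note eq
    also have "S * cmod ?R \<le> S * cmod (\<zeta> 0)"
      using S less assms by (intro mult_left_mono cmod_memory_sum_le) auto
    finally show ?case
      using S by simp
  qed
  then show ?thesis
    by auto
qed

end
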